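(* Let $\mathbb{N}=\{1,2,3,\ldots\}$, let $f:\mathbb{N}\times\mathbb{N}\to\mathbb{N}$ be the function $f(n,m)=2^n m$, and let $\mathcal{U}$ be any ultrafilter on $\mathbb{N}$ that satisfies the following property: ($\dagger$) for every $A\in\mathcal{U}$ and for every $L\in\mathbb{N}$ there exist $b,c\in\mathbb{N}$ such that $b, c, b+\ell c\in A$ for every $\ell\le L$. Then for every $A\in f_*(\mathcal{U}\otimes\mathcal{U})$ there exists an infinite sequence $(a_n)_{n\ge 1}$ of natural numbers with the property that for all $i,j,k$ with $i<2j$ and $2j+1<k$, setting $x:=2^{a_i}a_{2j}$ and $y:=2^{a_{2j+1}}a_k$, we have $\{x, y, 2^x y\}\subseteq A$.
   Context: For an ultrafilter $\mathcal{U}$ on a set $I$ and a function $g:I\to J$, the image ultrafilter $g_*(\mathcal{U})$ on $J$ is defined by $B\in g_*(\mathcal{U})\iff g^{-1}(B)\in\mathcal{U}$. For ultrafilters $\mathcal{U},\mathcal{V}$ on sets $I,J$, the tensor product $\mathcal{U}\otimes\mathcal{V}$ is the ultrafilter on $I\times J$ defined by $X\in\mathcal{U}\otimes\mathcal{V}\iff \{i\in I\mid \{j\in J\mid (i,j)\in X\}\in\mathcal{V}\}\in\mathcal{U}$. *)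

theory Defs
  imports Main
begin

definition ultrafilter_on :: "'a set \<Rightarrow> 'a set set \<Rightarrow> bool" where
  "ultrafilter_on I U \<longleftrightarrow>
     U \<subseteq> Pow I \<and> I \<in> U \<and> {} \<notin> U \<and>
     (\<forall>A B. A \<in> U \<longrightarrow> B \<in> U \<longrightarrow> A \<inter> B \<in> U) \<and>
     (\<forall>A B. A \<in> U \<longrightarrow> A \<subseteq> B \<longrightarrow> B \<subseteq> I \<longrightarrow> B \<in> U) \<and>
     (\<forall>A. A \<subseteq> I \<longrightarrow> A \<in> U \<or> I - A \<in> U)"

definition image_ultrafilter ::
    "'a set \<Rightarrow> 'b set \<Rightarrow> ('a \<Rightarrow> 'b) \<Rightarrow> 'a set set \<Rightarrow> 'b set set" where
  "image_ultrafilter I J g U = {B. B \<subseteq> J \<and> {i \<in> I. g i \<in> B} \<in> U}"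

definition tensor_ultrafilter ::
    "'a set \<Rightarrow> 'b set \<Rightarrow> 'a set set \<Rightarrow> 'b set set \<Rightarrow> ('a \<times> 'b) set set" where
  "tensor_ultrafilter I J U V =
     {X. X \<subseteq> I \<times> J \<and> {i \<in> I. {j \<in> J. (i, j) \<in> X} \<in> V} \<in> U}"

text \<open>Naturals starting at 1, as a carrier set inside the type \<^typ>\<open>nat\<close>.\<close>

definition posnat :: "nat set" where
  "posnat = {n. 1 \<le> n}"

definition exp_mult :: "nat \<times> nat \<Rightarrow> nat" where
  "exp_mult = (\<lambda>(n, m). 2 ^ n * m)"

definition dagger :: "nat set set \<Rightarrow> bool" where
  "dagger U \<longleftrightarrow>
     (\<forall>A\<in>U. \<forall>L\<in>posnat. \<exists>b\<in>posnat. \<exists>c\<in>posnat.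
        b \<in> A \<and> c \<in> A \<and> (\<forall>l\<in>posnat. l \<le> L \<longrightarrow> b + l * c \<in> A))"

lemma ultrafilter_on_image:
  assumes U: "ultrafilter_on I U" and g: "\<And>i. i \<in> I \<Longrightarrow> g i \<in> J"
  shows "ultrafilter_on J (image_ultrafilter I J g U)"
proof -
  have 1: "{i \<in> I. g i \<in> J} = I" using g by auto
  have 2: "{i \<in> I. g i \<in> A \<inter> B} = {i \<in> I. g i \<in> A} \<inter> {i \<in> I. g i \<in> B}" for A B by auto
  have 3: "{i \<in> I. g i \<in> J - A} = I - {i \<in> I. g i \<in> A}" for A using g by auto
  have up: "{i \<in> I. g i \<in> B} \<in> U" if "{i \<in> I. g i \<in> A} \<in> U" "A \<subseteq> B" for A B
  proof -
    have "{i \<in> I. g i \<in> A} \<subseteq> {i \<in> I. g i \<in> B}" "{i \<in> I. g i \<in> B} \<subseteq> I" using that(2) by auto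
    then show ?thesis using U that(1) unfolding ultrafilter_on_def by meson
  qed
  have c: "{i \<in> I. g i \<in> A} \<in> U \<or> I - {i \<in> I. g i \<in> A} \<in> U" for A
    using U unfolding ultrafilter_on_def by (metis (no_types, lifting) mem_Collect_eq subsetI)
  show ?thesis
    unfolding ultrafilter_on_def image_ultrafilter_def mem_Collect_eq 1 2 3
  proof (intro conjI allI impI)
    show "{B. B \<subseteq> J \<and> {i \<in> I. g i \<in> B} \<in> U} \<subseteq> Pow J" by auto
    show "\<not> ({} \<subseteq> J \<and> {i \<in> I. g i \<in> {}} \<in> U)" using U by (simp add: ultrafilter_on_def)
    fix A
    assume "A \<subseteq> J"
    then show "(A \<subseteq> J \<and> {i \<in> I. g i \<in> A} \<in> U) \<or> (J - A \<subseteq> J \<and> I - {i \<in> I. g i \<in> A} \<in> U)"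
      using c[of A] by blast
  qed (use U up in \<open>auto simp: ultrafilter_on_def\<close>)
qed

lemma ultrafilter_on_tensor:
  assumes U: "ultrafilter_on I U" and V: "ultrafilter_on J V"
  shows "ultrafilter_on (I \<times> J) (tensor_ultrafilter I J U V)"
proof -
  define S where "S X i = {j \<in> J. (i, j) \<in> X}" for X :: "('a \<times> 'b) set" and i
  define T where "T X = {i \<in> I. S X i \<in> V}" for X
  have Tsub: "T X \<subseteq> I" for X by (auto simp: T_def)
  have Ssub: "S X i \<subseteq> J" for X i by (auto simp: S_def)
  have upU: "B \<in> U" if "A \<in> U" "A \<subseteq> B" "B \<subseteq> I" for A B
    using U that unfolding ultrafilter_on_def by meson
  have upV: "B \<in> V" if "A \<in> V" "A \<subseteq> B" "B \<subseteq> J" for A B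
    using V that unfolding ultrafilter_on_def by meson
  have mem: "X \<in> tensor_ultrafilter I J U V \<longleftrightarrow> X \<subseteq> I \<times> J \<and> T X \<in> U" for X
    by (simp add: tensor_ultrafilter_def T_def S_def)
  have mono: "T A \<subseteq> T B" if "A \<subseteq> B" for A B
  proof
    fix i assume i: "i \<in> T A"
    have "S A i \<subseteq> S B i" using that by (auto simp: S_def)
    then show "i \<in> T B" using i upV[of "S A i" "S B i"] Ssub by (auto simp: T_def)
  qed
  have "S (I \<times> J) i = J" if "i \<in> I" for i using that by (auto simp: S_def)
  then have full: "T (I \<times> J) = I" using V by (auto simp: T_def ultrafilter_on_def)
  have empty: "T {} = {}" using V by (auto simp: T_def S_def ultrafilter_on_def)
  have S_Int: "S (A \<inter> B) i = S A i \<inter> S B i" for A B i by (auto simp: S_def)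
  have inter: "T A \<inter> T B \<subseteq> T (A \<inter> B)" for A B
    using V by (auto simp: T_def S_Int ultrafilter_on_def)
  have S_Diff: "S (I \<times> J - A) i = J - S A i" if "i \<in> I" for A i using that by (auto simp: S_def)
  have cV: "S A i \<in> V \<or> J - S A i \<in> V" for A i
    using V Ssub unfolding ultrafilter_on_def by meson
  have compl: "I - T A \<subseteq> T (I \<times> J - A)" for A
  proof
    fix i assume "i \<in> I - T A"
    then show "i \<in> T (I \<times> J - A)" using cV[of A i] S_Diff[of i A] by (simp add: T_def)
  qed
  have cU: "T A \<in> U \<or> I - T A \<in> U" for A
    using U Tsub unfolding ultrafilter_on_def by meson
  have intU: "T A \<inter> T B \<in> U" if "T A \<in> U" "T B \<in> U" for A B
    using U that unfolding ultrafilter_on_def by meson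
  show ?thesis
    unfolding ultrafilter_on_def mem
  proof (intro conjI allI impI)
    show "tensor_ultrafilter I J U V \<subseteq> Pow (I \<times> J)" by (auto simp: mem)
    show "T (I \<times> J) \<in> U" using U by (simp add: full ultrafilter_on_def)
    show "\<not> ({} \<subseteq> I \<times> J \<and> T {} \<in> U)" using U by (simp add: empty ultrafilter_on_def)
  next
    fix A B assume "A \<subseteq> I \<times> J \<and> T A \<in> U" "B \<subseteq> I \<times> J \<and> T B \<in> U"
    then show "A \<inter> B \<subseteq> I \<times> J" "T (A \<inter> B) \<in> U"
      using upU[OF intU inter Tsub] by blast+
  next
    fix A B assume "A \<subseteq> I \<times> J \<and> T A \<in> U" "A \<subseteq> B"
    then show "T B \<in> U" using upU[OF _ mono Tsub] by blast
  next
    fix A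
    show "(A \<subseteq> I \<times> J \<and> T A \<in> U) \<or> (I \<times> J - A \<subseteq> I \<times> J \<and> T (I \<times> J - A) \<in> U)"
      if "A \<subseteq> I \<times> J" using cU[of A] upU[OF _ compl Tsub] that by blast
  qed simp_all
qed

end

(* For e in D = {n. {m. 2^n m in A} in U} write A_e = {m. 2^e m in A}, so both D and the A_e are
   in U. A finite set E of exponents in D is enlarged step by step: property (dagger), applied to
   the intersection of D and all A_e, e in E, with L at least every 2^e, gives b and c, which become
   the next odd and even entries of the sequence, and b, c and all b + 2^e c are added to E. They
   are again in D, which handles 2^x y = 2^(b + 2^e c) a_k for all later a_k. *)

theory Submission
  imports Defs
begin

lemma ultrafilter_on_Int_INT:
  assumes U: "ultrafilter_on I U" and "finite E" "D \<in> U" "\<And>e. e \<in> E \<Longrightarrow> S e \<in> U"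
  shows "D \<inter> (\<Inter>e\<in>E. S e) \<in> U"
  using assms(2-4)
proof (induction E rule: finite_induct)
  case (insert e E)
  then have "S e \<in> U" "D \<inter> (\<Inter>e\<in>E. S e) \<in> U" by auto
  then have "S e \<inter> (D \<inter> (\<Inter>e\<in>E. S e)) \<in> U"
    using U unfolding ultrafilter_on_def by meson
  then show ?case by (simp add: Int_left_commute)
qed simp

lemma dagger_extend:
  assumes U: "ultrafilter_on posnat U" and dag: "dagger U"
    and D: "D \<in> U" and S: "\<And>e. e \<in> D \<Longrightarrow> S e \<in> U"
    and E: "finite E" "E \<subseteq> D"
  obtains b c where "b \<in> D" "c \<in> D"
    and "\<And>e. e \<in> E \<Longrightarrow> b \<in> S e \<and> c \<in> S e \<and> b + 2 ^ e * c \<in> D"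
proof -
  \<comment> \<open>The sum bounds each \<open>2 ^ e\<close> with \<open>e\<close> in
    \<open>E\<close>, so \<open>2 ^ e\<close> is an admissible multiplier \<open>l\<close>. The
    \<open>Suc\<close> keeps \<open>L\<close> positive when \<open>E\<close> is empty.\<close>
  define L :: nat where "L = Suc (\<Sum>e\<in>E. 2 ^ e)"
  have "D \<inter> (\<Inter>e\<in>E. S e) \<in> U"
    using ultrafilter_on_Int_INT[OF U E(1) D] S E(2) by blast
  moreover have "L \<in> posnat" by (simp add: L_def posnat_def)
  ultimately obtain b c where bc: "b \<in> D \<inter> (\<Inter>e\<in>E. S e)" "c \<in> D \<inter> (\<Inter>e\<in>E. S e)"
    and l: "\<And>l. l \<in> posnat \<Longrightarrow> l \<le> L \<Longrightarrow> b + l * c \<in> D \<inter> (\<Inter>e\<in>E. S e)"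
    using dag unfolding dagger_def by meson
  have "b + 2 ^ e * c \<in> D" if "e \<in> E" for e
  proof -
    have "(2::nat) ^ e \<le> (\<Sum>e\<in>E. 2 ^ e)" using that E(1) by (intro member_le_sum) auto
    then have "b + 2 ^ e * c \<in> D \<inter> (\<Inter>e\<in>E. S e)"
      by (intro l) (auto simp: L_def posnat_def)
    then show ?thesis by blast
  qed
  with bc show thesis using that[of b c] by blast
qed

text \<open>With \<open>S e\<close> the set of positive \<open>m\<close> such that
  \<open>2 ^ e * m\<close> lies in \<open>A\<close>, the four conclusions give, in order, positivity
  of the sequence and membership in \<open>A\<close> of \<open>x\<close>, \<open>y\<close> and
  \<open>2 ^ x * y\<close>.\<close>

lemma dagger_sequence:
  assumes U: "ultrafilter_on posnat U" and dag: "dagger U"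
    and D: "D \<in> U" and S: "\<And>e. e \<in> D \<Longrightarrow> S e \<in> U"
  obtains a :: "nat \<Rightarrow> nat"
  where "\<And>n. a n \<in> D"
    and "\<And>i j. i < 2 * j \<Longrightarrow> a (2 * j) \<in> S (a i)"
    and "\<And>j k. 2 * j + 1 < k \<Longrightarrow> a k \<in> S (a (2 * j + 1))"
    and "\<And>i j k. i < 2 * j \<Longrightarrow> 2 * j + 1 < k \<Longrightarrow>
           a k \<in> S (a (2 * j + 1) + 2 ^ a i * a (2 * j))"
proof -
  \<comment> \<open>A state \<open>(E, b, c)\<close> holds the exponents collected so far and the
    latest pair of entries. \<open>Q\<close> constrains a new pair only against the old
    \<open>E\<close>; nothing relates \<open>b'\<close> to \<open>c'\<close> through
    \<open>S\<close>.\<close>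
  define P where "P = (\<lambda>(E, b, c). finite E \<and> E \<subseteq> D \<and> b \<in> E \<and> c \<in> E)"
  define Q where "Q = (\<lambda>(E, b :: nat, c :: nat) (E', b', c').
    E \<subseteq> E' \<and> (\<forall>e\<in>E. b' \<in> S e \<and> c' \<in> S e \<and> b' + 2 ^ e * c' \<in> E'))"
  obtain d where d: "d \<in> D" using U D unfolding ultrafilter_on_def by (metis ex_in_conv)
  have "\<exists>f. \<forall>n. P (f n) \<and> Q (f n) (f (Suc n))"
  proof (rule dependent_nat_choice)
    \<comment> \<open>Stage 0 has no earlier exponents to respect, so one element \<open>d\<close>
      of \<open>D\<close> can serve as both entries.\<close>
    show "\<exists>x. P x" using d by (intro exI[of _ "({d}, d, d)"]) (simp add: P_def)
  next
    fix x and n :: nat assume x: "P x"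
    obtain E b0 c0 where Eeq: "x = (E, b0, c0)" by (cases x)
    from x have E: "finite E" "E \<subseteq> D" by (auto simp: Eeq P_def)
    obtain b c where bc: "b \<in> D" "c \<in> D"
      and e: "\<And>e. e \<in> E \<Longrightarrow> b \<in> S e \<and> c \<in> S e \<and> b + 2 ^ e * c \<in> D"
      using dagger_extend[OF U dag D _ E, of S] S by blast
    have "P (E \<union> {b, c} \<union> (\<lambda>e. b + 2 ^ e * c) ` E, b, c)"
      using E bc e by (auto simp: P_def)
    moreover have "Q x (E \<union> {b, c} \<union> (\<lambda>e. b + 2 ^ e * c) ` E, b, c)"
      using e by (auto simp: Q_def Eeq)
    ultimately show "\<exists>y. P y \<and> Q x y" by blast
  qed
  then obtain f where f: "\<And>n. P (f n)" "\<And>n. Q (f n) (f (Suc n))" by blast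
  define E b c where "E n = fst (f n)" and "b n = fst (snd (f n))" and "c n = snd (snd (f n))" for n
  have feq: "f n = (E n, b n, c n)" for n by (simp add: E_def b_def c_def)
  have ED: "E n \<subseteq> D" "b n \<in> E n" "c n \<in> E n" for n
    using f(1)[of n] by (auto simp: feq P_def)
  have step: "E n \<subseteq> E (Suc n)"
    "\<And>e. e \<in> E n \<Longrightarrow> b (Suc n) \<in> S e \<and> c (Suc n) \<in> S e \<and>
       b (Suc n) + 2 ^ e * c (Suc n) \<in> E (Suc n)" for n
    using f(2)[of n] by (auto simp: feq Q_def)
  have mono: "E m \<subseteq> E n" if "m \<le> n" for m n
    using lift_Suc_mono_le[of E, OF step(1) that] .
  \<comment> \<open>Stage \<open>n\<close> supplies \<open>c n\<close> at index \<open>2 * n\<close>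
    and \<open>b n\<close> at index \<open>2 * n + 1\<close>. Hence \<open>i < 2 * j\<close> puts
    \<open>a i\<close> at a stage before \<open>j\<close>, and \<open>2 * j + 1 < k\<close> puts
    \<open>a k\<close> at a stage after \<open>j\<close>.\<close>
  define a where "a n = (if even n then c (n div 2) else b (n div 2))" for n
  have aE: "a n \<in> E (n div 2)" for n using ED by (simp add: a_def)
  \<comment> \<open>An exponent present at stage \<open>m\<close> persists in all later sets
    \<open>E n\<close>, so it constrains every entry chosen after stage \<open>m\<close>.\<close>
  have aS: "a k \<in> S e" if e: "e \<in> E m" and k: "m < k div 2" for e k m
  proof -
    obtain n where n: "k div 2 = Suc n" "m \<le> n"
      using k by (cases "k div 2") auto
    then show ?thesis using step(2)[of e n] mono[OF n(2)] e n(1) by (auto simp: a_def)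
  qed
  show thesis
  proof (rule that)
    show "a n \<in> D" for n using aE ED(1) by blast
    show "a (2 * j) \<in> S (a i)" if "i < 2 * j" for i j
      using that by (intro aS[OF aE]) auto
    show "a k \<in> S (a (2 * j + 1))" if "2 * j + 1 < k" for j k
      using that by (intro aS[OF aE]) auto
    show "a k \<in> S (a (2 * j + 1) + 2 ^ a i * a (2 * j))" if ij: "i < 2 * j" and k: "2 * j + 1 < k"
      for i j k
    proof (rule aS)
      \<comment> \<open>Since \<open>a i\<close> is already in \<open>E n\<close> at the stage just
        before \<open>j\<close>, the step to \<open>j\<close> adds the combined exponent to
        \<open>E j\<close>, in time for every \<open>a k\<close> of a later stage.\<close>
      obtain n where n: "j = Suc n" "i div 2 \<le> n" using ij by (cases j) auto
      then have "a i \<in> E n" using aE[of i] mono by blast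
      then show "a (2 * j + 1) + 2 ^ a i * a (2 * j) \<in> E j"
        using step(2)[of "a i" n] by (simp add: n(1) a_def)
      show "j < k div 2" using k by auto
    qed
  qed
qed

theorem theorem2:
  fixes U :: "nat set set"
  assumes "ultrafilter_on posnat U"
    and "dagger U"
  shows "\<forall>A \<in> image_ultrafilter (posnat \<times> posnat) posnat exp_mult
                (tensor_ultrafilter posnat posnat U U).
    \<exists>a :: nat \<Rightarrow> nat. (\<forall>n\<in>posnat. a n \<in> posnat) \<and>
      (\<forall>i\<in>posnat. \<forall>j\<in>posnat. \<forall>k\<in>posnat. i < 2 * j \<longrightarrow> 2 * j + 1 < k \<longrightarrow>
        (let x = 2 ^ a i * a (2 * j); y = 2 ^ a (2 * j + 1) * a k
         in {x, y, 2 ^ x * y} \<subseteq> A))"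
proof
  fix A assume A: "A \<in> image_ultrafilter (posnat \<times> posnat) posnat exp_mult
                (tensor_ultrafilter posnat posnat U U)"
  define S where "S e = {m \<in> posnat. 2 ^ e * m \<in> A}" for e
  define D where "D = {n \<in> posnat. S n \<in> U}"
  have "{i \<in> posnat. {j \<in> posnat. (i, j) \<in> {p \<in> posnat \<times> posnat. exp_mult p \<in> A}} \<in> U} = D"
    by (auto simp: D_def S_def exp_mult_def cong: conj_cong)
  then have "D \<in> U"
    using A by (simp add: image_ultrafilter_def tensor_ultrafilter_def)
  moreover have "S e \<in> U" if "e \<in> D" for e using that by (simp add: D_def)
  ultimately obtain a :: "nat \<Rightarrow> nat" where a: "\<And>n. a n \<in> D"
    "\<And>i j. i < 2 * j \<Longrightarrow> a (2 * j) \<in> S (a i)"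
    "\<And>j k. 2 * j + 1 < k \<Longrightarrow> a k \<in> S (a (2 * j + 1))"
    "\<And>i j k. i < 2 * j \<Longrightarrow> 2 * j + 1 < k \<Longrightarrow> a k \<in> S (a (2 * j + 1) + 2 ^ a i * a (2 * j))"
    using dagger_sequence[OF assms, of D S] by blast
  have "{x, y, 2 ^ x * y} \<subseteq> A"
    if "i < 2 * j" "2 * j + 1 < k" "x = 2 ^ a i * a (2 * j)" "y = 2 ^ a (2 * j + 1) * a k"
    for i j k x y
  proof -
    \<comment> \<open>The factor \<open>2 ^ a (2 * j + 1)\<close> of \<open>y\<close> merges with
      \<open>2 ^ x\<close>, turning the product into the combined exponent applied to
      \<open>a k\<close>.\<close>
    have "2 ^ x * y = 2 ^ (a (2 * j + 1) + 2 ^ a i * a (2 * j)) * a k"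
      by (simp add: that(3,4) power_add)
    then have "2 ^ x * y \<in> A" using a(4)[OF that(1,2)] by (simp add: S_def)
    moreover have "x \<in> A" "y \<in> A"
      using a(2)[OF that(1)] a(3)[OF that(2)] by (simp_all add: S_def that(3,4))
    ultimately show ?thesis by blast
  qed
  moreover have "a n \<in> posnat" for n using a(1)[of n] by (simp add: D_def)
  ultimately show "\<exists>a :: nat \<Rightarrow> nat. (\<forall>n\<in>posnat. a n \<in> posnat) \<and>
      (\<forall>i\<in>posnat. \<forall>j\<in>posnat. \<forall>k\<in>posnat. i < 2 * j \<longrightarrow> 2 * j + 1 < k \<longrightarrow>
        (let x = 2 ^ a i * a (2 * j); y = 2 ^ a (2 * j + 1) * a k
         in {x, y, 2 ^ x * y} \<subseteq> A))"
    unfolding Let_def by blast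
qed

end
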